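(* Let $\alpha \in \mathbb{R}$, let $Z \sim BASN_2(\alpha)$, and let $n$ be a positive integer. Then $$E(Z^n) = \begin{cases} \dfrac{2^{-\frac{n+4}{2}}\left\{\dfrac{\alpha^4 (n+4)!}{((n+4)/2)!} + \dfrac{16\alpha^2 (n+2)!}{((n+2)/2)!} + \dfrac{16\, n!}{(n/2)!}\right\}}{C_2(\alpha)(2+\alpha^2)^2}, & \text{when } n \text{ is even},\\[3ex] \dfrac{-2^{\frac{1-n}{2}}\,\alpha\left\{\dfrac{\alpha^2 (n+3)!}{((n+3)/2)!} + \dfrac{4 (n+1)!}{((n+1)/2)!}\right\}}{C_2(\alpha)(2+\alpha^2)^2}, & \text{when } n \text{ is odd}. \end{cases}$$
   Context: Here $\varphi(z) = \frac{1}{\sqrt{2\pi}} e^{-z^2/2}$ is the standard normal probability density function. For $\alpha\in\mathbb{R}$, put $C_2(\alpha) = 3 - \frac{4}{2+\alpha^2}$. A real random variable $Z$ follows the Balakrishnan alpha skew normal distribution with parameter $\alpha$, written $Z\sim BASN_2(\alpha)$, if it has the probability density function $$f_Z(z;\alpha) = \frac{1}{C_2(\alpha)}\left(\frac{(1-\alpha z)^2+1}{2+\alpha^2}\right)^2\varphi(z),\qquad z\in\mathbb{R}.$$ $E$ denotes expectation. *)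

theory Defs
  imports "HOL-Probability.Probability"
begin

definition basn2_C :: "real \<Rightarrow> real" where
  "basn2_C \<alpha> = 3 - 4 / (2 + \<alpha>\<^sup>2)"

definition basn2_density :: "real \<Rightarrow> real \<Rightarrow> real" where
  "basn2_density \<alpha> z =
     1 / basn2_C \<alpha> * (((1 - \<alpha> * z)\<^sup>2 + 1) / (2 + \<alpha>\<^sup>2))\<^sup>2 * std_normal_density z"

definition basn2_distributed :: "'a measure \<Rightarrow> ('a \<Rightarrow> real) \<Rightarrow> real \<Rightarrow> bool" where
  "basn2_distributed M Z \<alpha> \<longleftrightarrow> distributed M lborel Z (\<lambda>z. ennreal (basn2_density \<alpha> z))"

end

theory Submission
  imports Defs
begin

text \<open>
  Up to the constant \<open>1 / (C (2 + \<alpha>\<^sup>2)\<^sup>2)\<close>, the density of \<open>Z\<close> is a quartic polynomial times the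
  standard normal density \<open>\<phi>\<close>:
  \<open>((1 - \<alpha>z)\<^sup>2 + 1)\<^sup>2 = 4 - 8\<alpha>z + 8\<alpha>\<^sup>2z\<^sup>2 - 4\<alpha>\<^sup>3z\<^sup>3 + \<alpha>\<^sup>4z\<^sup>4\<close>.
  Hence the \<open>n\<close>-th moment of \<open>Z\<close> is a linear combination of the normal moments of orders
  \<open>n, \<dots>, n + 4\<close> (lemma \<open>basn2_moment_combination\<close>). The normal moments of odd order vanish, so for
  even \<open>n\<close> only the terms with even powers of \<open>\<alpha>\<close> survive, and for odd \<open>n\<close> only those with odd
  powers. Since \<open>E(X\<^bsup>2k\<^esup>) = (2k)! / (2\<^sup>k k!)\<close> for standard normal \<open>X\<close>, collecting the powers of
  \<open>2\<close> in what survives gives the two formulas.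
\<close>

definition std_normal_moment :: "nat \<Rightarrow> real" where
  "std_normal_moment k = (if even k then fact k / (2 ^ (k div 2) * fact (k div 2)) else 0)"

lemma has_bochner_integral_std_normal_moment:
  "has_bochner_integral lborel (\<lambda>x. std_normal_density x * x ^ k) (std_normal_moment k)"
proof (cases "even k")
  case True
  then obtain j where "k = 2 * j" by (elim evenE)
  then show ?thesis
    using std_normal_moment_even[of j] by (simp add: std_normal_moment_def)
next
  case False
  then obtain j where "k = 2 * j + 1" by (elim oddE)
  then show ?thesis
    using std_normal_moment_odd[of j] by (simp add: std_normal_moment_def)
qed

lemma basn2_C_pos: "basn2_C \<alpha> > 0"
proof -
  have "4 / (2 + \<alpha>\<^sup>2) \<le> 2"
    by (simp add: add_pos_nonneg divide_le_eq)
  then show ?thesis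
    by (simp add: basn2_C_def)
qed

lemma basn2_density_nonneg: "basn2_density \<alpha> z \<ge> 0"
  using basn2_C_pos[of \<alpha>] by (simp add: basn2_density_def)

text \<open>
  Multiplying the quartic by \<open>z\<^sup>n\<close> shifts its exponents by \<open>n\<close>, and integrating against \<open>\<phi>\<close> replaces
  each power of \<open>z\<close> by the normal moment of that order.
\<close>

lemma basn2_moment_combination:
  "has_bochner_integral lborel (\<lambda>z. basn2_density \<alpha> z * z ^ n)
     ((4 * std_normal_moment n - 8 * \<alpha> * std_normal_moment (n + 1)
       + 8 * \<alpha>\<^sup>2 * std_normal_moment (n + 2) - 4 * \<alpha> ^ 3 * std_normal_moment (n + 3)
       + \<alpha> ^ 4 * std_normal_moment (n + 4)) / (basn2_C \<alpha> * (2 + \<alpha>\<^sup>2)\<^sup>2))"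
proof -
  let ?g = "\<lambda>k z. std_normal_density z * z ^ k"
  have expand: "((1 - \<alpha> * z)\<^sup>2 + 1)\<^sup>2 * z ^ n =
      4 * z ^ n - 8 * \<alpha> * z ^ (n + 1) + 8 * \<alpha>\<^sup>2 * z ^ (n + 2)
      - 4 * \<alpha> ^ 3 * z ^ (n + 3) + \<alpha> ^ 4 * z ^ (n + 4)" for z
    by (simp add: power_add) algebra
  have "basn2_density \<alpha> z * z ^ n =
      std_normal_density z * (((1 - \<alpha> * z)\<^sup>2 + 1)\<^sup>2 * z ^ n) / (basn2_C \<alpha> * (2 + \<alpha>\<^sup>2)\<^sup>2)" for z
    by (simp add: basn2_density_def power_divide)
  moreover have "std_normal_density z * (((1 - \<alpha> * z)\<^sup>2 + 1)\<^sup>2 * z ^ n) =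
      4 * ?g n z - 8 * \<alpha> * ?g (n + 1) z + 8 * \<alpha>\<^sup>2 * ?g (n + 2) z
      - 4 * \<alpha> ^ 3 * ?g (n + 3) z + \<alpha> ^ 4 * ?g (n + 4) z" for z
    unfolding expand by (simp only: algebra_simps)
  ultimately have density_eq: "(\<lambda>z. basn2_density \<alpha> z * z ^ n) =
      (\<lambda>z. (4 * ?g n z - 8 * \<alpha> * ?g (n + 1) z + 8 * \<alpha>\<^sup>2 * ?g (n + 2) z
        - 4 * \<alpha> ^ 3 * ?g (n + 3) z + \<alpha> ^ 4 * ?g (n + 4) z) / (basn2_C \<alpha> * (2 + \<alpha>\<^sup>2)\<^sup>2))"
    by (simp only:)
  show ?thesis
    unfolding density_eq
    by (intro has_bochner_integral_divide_zero has_bochner_integral_add has_bochner_integral_diff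
        has_bochner_integral_mult_right has_bochner_integral_std_normal_moment)
qed

theorem proposition2:
  fixes M :: "'a measure" and Z :: "'a \<Rightarrow> real" and \<alpha> :: real and n :: nat
  assumes "prob_space M"
    and "basn2_distributed M Z \<alpha>"
    and "n > 0"
  shows "integrable M (\<lambda>x. Z x ^ n) \<and>
    (\<integral>x. Z x ^ n \<partial>M) =
      (if even n then
         2 powr (- ((real n + 4) / 2)) *
           (\<alpha> ^ 4 * fact (n + 4) / fact ((n + 4) div 2)
            + 16 * \<alpha>\<^sup>2 * fact (n + 2) / fact ((n + 2) div 2)
            + 16 * fact n / fact (n div 2))
         / (basn2_C \<alpha> * (2 + \<alpha>\<^sup>2)\<^sup>2)
       else
         - (2 powr ((1 - real n) / 2)) * \<alpha> *
           (\<alpha>\<^sup>2 * fact (n + 3) / fact ((n + 3) div 2)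
            + 4 * fact (n + 1) / fact ((n + 1) div 2))
         / (basn2_C \<alpha> * (2 + \<alpha>\<^sup>2)\<^sup>2))"
proof -
  let ?N = "basn2_C \<alpha> * (2 + \<alpha>\<^sup>2)\<^sup>2"
  let ?m = std_normal_moment
  let ?S = "4 * ?m n - 8 * \<alpha> * ?m (n + 1) + 8 * \<alpha>\<^sup>2 * ?m (n + 2) - 4 * \<alpha> ^ 3 * ?m (n + 3)
    + \<alpha> ^ 4 * ?m (n + 4)"
  have half_power: "2 powr (- real j) = 1 / (2::real) ^ j" for j
    by (simp add: powr_minus_divide powr_realpow)
  have distr: "distributed M lborel Z (\<lambda>z. ennreal (basn2_density \<alpha> z))"
    using assms(2) by (simp add: basn2_distributed_def)
  note moment = basn2_moment_combination[of \<alpha> n]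
  have "integrable M (\<lambda>x. Z x ^ n)"
    using distributed_integrable[OF distr, of "\<lambda>z. z ^ n"] moment
    by (simp add: basn2_density_nonneg has_bochner_integral_iff)
  moreover have "(\<integral>x. Z x ^ n \<partial>M) = ?S / ?N"
    using distributed_integral[OF distr, of "\<lambda>z. z ^ n"] moment
    by (simp add: basn2_density_nonneg has_bochner_integral_iff)
  moreover have "?S = 2 powr (- ((real n + 4) / 2)) *
           (\<alpha> ^ 4 * fact (n + 4) / fact ((n + 4) div 2)
            + 16 * \<alpha>\<^sup>2 * fact (n + 2) / fact ((n + 2) div 2)
            + 16 * fact n / fact (n div 2))" if "even n"
  proof -
    from that obtain k where n: "n = 2 * k" by (elim evenE)
    have "- ((real n + 4) / 2) = - real (k + 2)"
      by (simp add: n field_simps)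
    then have powr: "2 powr (- ((real n + 4) / 2)) = 1 / (2::real) ^ (k + 2)"
      by (simp only: half_power)
    have m: "?m n = fact n / (2 ^ k * fact (n div 2))"
      "?m (n + 2) = fact (n + 2) / (2 ^ (k + 1) * fact ((n + 2) div 2))"
      "?m (n + 4) = fact (n + 4) / (2 ^ (k + 2) * fact ((n + 4) div 2))"
      "?m (n + 1) = 0" "?m (n + 3) = 0"
      by (simp_all add: n std_normal_moment_def del: fact_Suc)
    show ?thesis
      unfolding powr m by (simp add: power_add field_simps del: fact_Suc)
  qed
  moreover have "?S = - (2 powr ((1 - real n) / 2)) * \<alpha> *
           (\<alpha>\<^sup>2 * fact (n + 3) / fact ((n + 3) div 2)
            + 4 * fact (n + 1) / fact ((n + 1) div 2))" if "odd n"
  proof -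
    from that obtain k where n: "n = 2 * k + 1" by (elim oddE)
    have "(1 - real n) / 2 = - real k"
      by (simp add: n)
    then have powr: "2 powr ((1 - real n) / 2) = 1 / (2::real) ^ k"
      by (simp only: half_power)
    have m: "?m (n + 1) = fact (n + 1) / (2 ^ (k + 1) * fact ((n + 1) div 2))"
      "?m (n + 3) = fact (n + 3) / (2 ^ (k + 2) * fact ((n + 3) div 2))"
      "?m n = 0" "?m (n + 2) = 0" "?m (n + 4) = 0"
      by (simp_all add: n std_normal_moment_def del: fact_Suc)
    show ?thesis
      unfolding powr m
      by (simp add: power_add field_simps power2_eq_square power3_eq_cube del: fact_Suc)
  qed
  ultimately show ?thesis
    by (cases "even n") (simp_all only: if_True if_False simp_thms)
qed

end
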